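(* Let $\mathbb{F}_q$ be a finite field with $q\equiv -1\pmod 3$. Then every elliptic curve over $\mathbb{F}_q$ with an $\mathbb{F}_q$-rational point of order $3$ is isomorphic over $\mathbb{F}_q$ to a curve with equation $y^2+axy+y=x^3$ with $a\in\mathbb{F}_q$, $a\neq 3$. Moreover, for such a curve the group $E(\mathbb{F}_q)[3]$ of $\mathbb{F}_q$-rational $3$-torsion points is cyclic. *)

theory Defs
  imports
    "HOL-Algebra.Algebraic_Closure_Type"
    "HOL-Algebra.Elementary_Groups"
    "HOL-Number_Theory.Cong"
    "HOL-Library.Cardinality"
begin

(* Weierstrass a1 a2 a3 a4 a6 stands for y^2 + a1 x y + a3 y = x^3 + a2 x^2 + a4 x + a6. *)
datatype 'a weierstrass =
  Weierstrass (wa1: 'a) (wa2: 'a) (wa3: 'a) (wa4: 'a) (wa6: 'a)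

datatype 'a point = Infinity | Affine 'a 'a

definition weq :: "'a::field weierstrass \<Rightarrow> 'a \<Rightarrow> 'a \<Rightarrow> 'a" where
  "weq E x y = y\<^sup>2 + wa1 E * x * y + wa3 E * y
                - (x ^ 3 + wa2 E * x\<^sup>2 + wa4 E * x + wa6 E)"

definition weq_dx :: "'a::field weierstrass \<Rightarrow> 'a \<Rightarrow> 'a \<Rightarrow> 'a" where
  "weq_dx E x y = wa1 E * y - (3 * x\<^sup>2 + 2 * wa2 E * x + wa4 E)"

definition weq_dy :: "'a::field weierstrass \<Rightarrow> 'a \<Rightarrow> 'a \<Rightarrow> 'a" where
  "weq_dy E x y = 2 * y + wa1 E * x + wa3 E"

definition points :: "'a::field weierstrass \<Rightarrow> 'a point set" where
  "points E = insert Infinity {Affine x y | x y. weq E x y = 0}"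

abbreviation closure_curve :: "'a::field weierstrass \<Rightarrow> 'a alg_closure weierstrass" where
  "closure_curve E \<equiv> map_weierstrass to_ac E"

(* Smoothness of the projective curve over the algebraic closure. Only affine points
   need checking: at (0 : 1 : 0) the Z-derivative of the homogenized equation is 1. *)
definition elliptic_curve :: "'a::field weierstrass \<Rightarrow> bool" where
  "elliptic_curve E \<longleftrightarrow>
     \<not> (\<exists>x y. weq (closure_curve E) x y = 0 \<and>
             weq_dx (closure_curve E) x y = 0 \<and>
             weq_dy (closure_curve E) x y = 0)"

(* Chord-and-tangent law. In the tangent case x1 = x2 the two points are equal whenever
   they both lie on the curve, since they are not opposite to each other. *)
fun pt_add :: "'a::field weierstrass \<Rightarrow> 'a point \<Rightarrow> 'a point \<Rightarrow> 'a point" where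
  "pt_add E Infinity Q = Q"
| "pt_add E (Affine x1 y1) Infinity = Affine x1 y1"
| "pt_add E (Affine x1 y1) (Affine x2 y2) =
     (if x1 = x2 \<and> y2 = - y1 - wa1 E * x1 - wa3 E then Infinity
      else
        let l = (if x1 = x2
                 then (3 * x1\<^sup>2 + 2 * wa2 E * x1 + wa4 E - wa1 E * y1) /
                      (2 * y1 + wa1 E * x1 + wa3 E)
                 else (y2 - y1) / (x2 - x1));
            x3 = l\<^sup>2 + wa1 E * l - wa2 E - x1 - x2;
            y3 = l * (x3 - x1) + y1
        in Affine x3 (- y3 - wa1 E * x3 - wa3 E))"

definition point_group :: "'a::field weierstrass \<Rightarrow> 'a point monoid" where
  "point_group E = \<lparr>carrier = points E, monoid.mult = pt_add E, one = Infinity\<rparr>"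

(* Unlike group.ord, this unfolds without a proof that the structure is a group. *)
definition has_order :: "('g, 'b) monoid_scheme \<Rightarrow> 'g \<Rightarrow> nat \<Rightarrow> bool" where
  "has_order G g n \<longleftrightarrow>
     g \<in> carrier G \<and> n > 0 \<and> g [^]\<^bsub>G\<^esub> n = \<one>\<^bsub>G\<^esub> \<and>
     (\<forall>m. 0 < m \<and> m < n \<longrightarrow> g [^]\<^bsub>G\<^esub> m \<noteq> \<one>\<^bsub>G\<^esub>)"

definition torsion :: "nat \<Rightarrow> 'g monoid \<Rightarrow> 'g monoid" where
  "torsion n G = G\<lparr>carrier := {g \<in> carrier G. g [^]\<^bsub>G\<^esub> n = \<one>\<^bsub>G\<^esub>}\<rparr>"

(* Homogeneous coordinates (X, Y, Z) in the projective plane, with x = X/Z, y = Y/Z. *)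
fun hom_coords :: "'a::field point \<Rightarrow> 'a \<times> 'a \<times> 'a" where
  "hom_coords Infinity = (0, 1, 0)"
| "hom_coords (Affine x y) = (x, y, 1)"

(* The value of the ternary form of degree d over the base field in which
   x^i y^j z^(d-i-j) has coefficient c i j. *)
definition form_val ::
  "nat \<Rightarrow> (nat \<Rightarrow> nat \<Rightarrow> 'a::field) \<Rightarrow>
   'a alg_closure \<times> 'a alg_closure \<times> 'a alg_closure \<Rightarrow> 'a alg_closure" where
  "form_val d c = (\<lambda>(x, y, z).
     \<Sum>i\<le>d. \<Sum>j\<le>d - i. to_ac (c i j) * x ^ i * y ^ j * z ^ (d - i - j))"

definition forms_at ::
  "nat \<Rightarrow> (nat \<Rightarrow> nat \<Rightarrow> 'a::field) \<Rightarrow> (nat \<Rightarrow> nat \<Rightarrow> 'a) \<Rightarrow> (nat \<Rightarrow> nat \<Rightarrow> 'a) \<Rightarrow>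
   'a alg_closure point \<Rightarrow> 'a alg_closure \<times> 'a alg_closure \<times> 'a alg_closure" where
  "forms_at d F G H P =
     (form_val d F (hom_coords P), form_val d G (hom_coords P), form_val d H (hom_coords P))"

(* Morphisms of projective curves defined over the base field, as maps on the points over
   the algebraic closure: around each point, the map is given by three forms of the same
   degree with coefficients in the base field and without a common zero at that point. *)
definition curve_morphism ::
  "'a::field weierstrass \<Rightarrow> 'a weierstrass \<Rightarrow>
   ('a alg_closure point \<Rightarrow> 'a alg_closure point) \<Rightarrow> bool" where
  "curve_morphism E E' \<phi> \<longleftrightarrow>
     (\<forall>P \<in> points (closure_curve E). \<phi> P \<in> points (closure_curve E')) \<and>
     (\<forall>P \<in> points (closure_curve E). \<exists>d F G H.
        forms_at d F G H P \<noteq> (0, 0, 0) \<and>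
        (\<forall>Q \<in> points (closure_curve E). forms_at d F G H Q \<noteq> (0, 0, 0) \<longrightarrow>
           (\<exists>k. k \<noteq> 0 \<and>
              forms_at d F G H Q = (case hom_coords (\<phi> Q) of (x, y, z) \<Rightarrow> (k * x, k * y, k * z)))))"

(* Isomorphism over the base field of the curves with distinguished point Infinity. *)
definition isomorphic_over_base ::
  "'a::field weierstrass \<Rightarrow> 'a weierstrass \<Rightarrow> bool" where
  "isomorphic_over_base E E' \<longleftrightarrow>
     (\<exists>\<phi> \<psi>. curve_morphism E E' \<phi> \<and> curve_morphism E' E \<psi> \<and> \<phi> Infinity = Infinity \<and>
        (\<forall>P \<in> points (closure_curve E). \<psi> (\<phi> P) = P) \<and>
        (\<forall>P \<in> points (closure_curve E'). \<phi> (\<psi> P) = P))"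

end

theory Submission
  imports Defs "HOL-Number_Theory.Residues"
begin

text \<open>
  A point \<open>P = (x0, y0)\<close> has order 3 iff it is a flex: the tangent line at \<open>P\<close> meets the curve
  only at \<open>P\<close>. Moving \<open>P\<close> to the origin and its tangent to the \<open>x\<close>-axis turns the equation into
  \<open>y\<^sup>2 + A x y + B y = x\<^sup>3\<close> with \<open>B \<noteq> 0\<close>. If \<open>q \<equiv> -1 (mod 3)\<close> then cubing is a bijection of
  \<open>F\<^sub>q\<close>, so \<open>B = u\<^sup>3\<close> can be scaled to 1, and the discriminant \<open>a\<^sup>3 - 27\<close> vanishes only for \<open>a = 3\<close>.
  A rational flex \<open>(x, y)\<close> of \<open>y\<^sup>2 + a x y + y = x\<^sup>3\<close> with \<open>x \<noteq> 0\<close> would make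
  \<open>(1 - y) / (2 y + a x + 1)\<close> a primitive cube root of unity (this is the Weil pairing made
  explicit), and \<open>F\<^sub>q\<close> has none. So the rational 3-torsion consists of \<open>P\<close>, \<open>-P\<close> and the point
  at infinity only, which makes associativity a matter of checking a table.
\<close>

section \<open>Cubing in a finite field with q = -1 mod 3\<close>

lemma three_neq_zero:
  assumes "[int CARD('a::{field,finite}) = - 1] (mod 3)"
  shows "(3 :: 'a) \<noteq> 0"
proof
  assume "(3 :: 'a) = 0"
  then have "of_nat 3 = (0 :: 'a)" by simp
  then have "CHAR('a) dvd 3" by (simp only: of_nat_eq_0_iff_char_dvd)
  moreover have "prime (3 :: nat)" by simp
  ultimately have "CHAR('a) = 1 \<or> CHAR('a) = 3"
    unfolding prime_nat_iff by blast
  then have "CHAR('a) = 3" by simp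
  then have "3 dvd CARD('a)" using CHAR_dvd_CARD[where 'a = 'a] by simp
  then show False using assms unfolding cong_def by presburger
qed

(* The library's finite_field_power_card_eq_same is stated for the class finite_field, of which
   the sort {field,finite} is not an instance. *)
lemma power_card_minus_1_eq_1:
  assumes "x \<noteq> (0 :: 'a::{field,finite})"
  shows "x ^ (CARD('a) - 1) = 1"
proof -
  let ?U = "UNIV - {0 :: 'a}"
  have "bij_betw ((*) x) ?U ?U"
    by (rule bij_betw_byWitness[where f' = "\<lambda>y. y / x"]) (use assms in auto)
  then have "(\<Prod>y\<in>?U. x * y) = \<Prod>?U"
    by (rule prod.reindex_bij_betw)
  then have "x ^ card ?U * \<Prod>?U = \<Prod>?U"
    by (simp only: prod.distrib prod_constant)
  moreover have "\<Prod>?U \<noteq> 0" by simp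
  moreover have "card ?U = CARD('a) - 1" by (simp add: card_Diff_singleton)
  ultimately show ?thesis by simp
qed

lemma inj_cube:
  assumes "[int CARD('a::{field,finite}) = - 1] (mod 3)"
  shows "inj (\<lambda>x :: 'a. x ^ 3)"
proof (rule injI)
  fix x y :: 'a assume xy: "x ^ 3 = y ^ 3"
  show "x = y"
  proof (cases "y = 0")
    case True
    then show ?thesis using xy by simp
  next
    case False
    define w where "w = x / y"
    have w: "w ^ 3 = 1" using False xy by (simp add: w_def power_divide)
    then have "w \<noteq> 0" by auto
    have "CARD('a) mod 3 = 2" using assms unfolding cong_def by presburger
    \<comment> \<open>Since q - 1 leaves remainder 1 modulo 3, a cube root of unity satisfies w =
      w^(q-1) = 1.\<close>
    then have "CARD('a) - 1 = 3 * (CARD('a) div 3) + 1" by presburger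
    then have "w ^ (CARD('a) - 1) = (w ^ 3) ^ (CARD('a) div 3) * w"
      by (simp only: power_add power_mult power_one_right)
    then have "w = 1" using power_card_minus_1_eq_1[OF \<open>w \<noteq> 0\<close>] by (simp add: w)
    then show ?thesis using False by (simp add: w_def)
  qed
qed

text \<open>A root would be a cube root of unity, hence 1 by \<open>inj_cube\<close>, and then 3 =
  0.\<close>

lemma no_primitive_cube_root:
  assumes "[int CARD('a::{field,finite}) = - 1] (mod 3)"
  shows "w\<^sup>2 + w + 1 \<noteq> (0 :: 'a)"
proof
  assume w: "w\<^sup>2 + w + 1 = 0"
  have "w ^ 3 = 1" using w by Groebner_Basis.algebra
  then have "w = 1" using injD[OF inj_cube[OF assms], of w 1] by simp
  then show False using w three_neq_zero[OF assms] by simp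
qed

section \<open>Flexes and points killed by 3\<close>

text \<open>\<open>l\<close> is the slope of the tangent. A line of slope \<open>l\<close> meets the
  curve in three points whose abscissas sum to l^2 + a1 l - a2, so the last condition places the
  third intersection at \<open>x\<close> too.\<close>

definition flex :: "'a::field weierstrass \<Rightarrow> 'a \<Rightarrow> 'a \<Rightarrow> 'a \<Rightarrow> bool" where
  "flex E x y l \<longleftrightarrow>
     weq E x y = 0 \<and> weq_dy E x y \<noteq> 0 \<and> weq_dx E x y + l * weq_dy E x y = 0 \<and>
     l\<^sup>2 + wa1 E * l - wa2 E = 3 * x"

abbreviation normal_form :: "'a::field \<Rightarrow> 'a weierstrass" where
  "normal_form a \<equiv> Weierstrass a 0 1 0 0"

definition neg_y :: "'a::field weierstrass \<Rightarrow> 'a \<Rightarrow> 'a \<Rightarrow> 'a" where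
  "neg_y E x y = - y - wa1 E * x - wa3 E"

lemma eq_neg_y_iff: "y = neg_y E x y \<longleftrightarrow> weq_dy E x y = 0"
proof -
  have "weq_dy E x y = y - neg_y E x y" by (simp add: weq_dy_def neg_y_def)
  then show ?thesis by simp
qed

lemma pt_add_flex_double:
  assumes "flex E x y l"
  shows "pt_add E (Affine x y) (Affine x y) = Affine x (neg_y E x y)"
proof -
  have d: "2 * y + wa1 E * x + wa3 E \<noteq> 0" and
    l: "(3 * x\<^sup>2 + 2 * wa2 E * x + wa4 E - wa1 E * y) / (2 * y + wa1 E * x + wa3 E) = l" and
    x3: "l\<^sup>2 + wa1 E * l - wa2 E - x - x = x"
    using assms by (auto simp: flex_def weq_dx_def weq_dy_def field_simps)
  have "y \<noteq> - y - wa1 E * x - wa3 E"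
    using d eq_neg_y_iff[of y E x] by (simp add: neg_y_def weq_dy_def)
  then show ?thesis
    by (simp only: pt_add.simps(3) Let_def l x3 neg_y_def simp_thms if_True if_False
        diff_self mult_zero_right add_0)
qed

lemma pt_add_neg: "pt_add E (Affine x y) (Affine x (neg_y E x y)) = Infinity"
  by (simp add: neg_y_def)

lemma neg_y_neg_y [simp]: "neg_y E x (neg_y E x y) = y"
  by (simp add: neg_y_def)

lemma pt_pow_3: "g [^]\<^bsub>point_group E\<^esub> (3 :: nat) = pt_add E (pt_add E g g) g"
  by (simp add: numeral_3_eq_3 point_group_def)

text \<open>3P = O means 2P = -P, so the tangent at P meets the curve a third time at P
  itself.\<close>

lemma triple_eq_Infinity_iff_flex:
  assumes "weq E x y = 0"
  shows "pt_add E (pt_add E (Affine x y) (Affine x y)) (Affine x y) = Infinity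
           \<longleftrightarrow> (\<exists>l. flex E x y l)" (is "?L \<longleftrightarrow> ?R")
proof
  assume ?R
  then obtain l where "flex E x y l" by blast
  then show ?L
    using pt_add_neg[of E x "neg_y E x y"] by (simp add: pt_add_flex_double del: pt_add.simps(3))
next
  assume L: ?L
  then have y: "y \<noteq> - y - wa1 E * x - wa3 E" by auto
  then have d: "weq_dy E x y \<noteq> 0" using eq_neg_y_iff[of y E x] by (simp add: neg_y_def)
  define l where "l = (3 * x\<^sup>2 + 2 * wa2 E * x + wa4 E - wa1 E * y) / (2 * y + wa1 E * x + wa3 E)"
  have "l * weq_dy E x y = 3 * x\<^sup>2 + 2 * wa2 E * x + wa4 E - wa1 E * y"
    using d by (simp add: l_def weq_dy_def)
  then have "weq_dx E x y + l * weq_dy E x y = 0"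
    by (simp add: weq_dx_def)
  moreover have "l\<^sup>2 + wa1 E * l - wa2 E - x - x = x"
    using L y by (simp add: Let_def flip: l_def split: if_splits)
  then have "l\<^sup>2 + wa1 E * l - wa2 E = 3 * x" by (simp add: algebra_simps)
  ultimately show ?R using assms d unfolding flex_def by blast
qed

text \<open>Negation preserves the curve and sends lines of slope \<open>l\<close> to lines of slope
  \<open>- l - wa1 E\<close>.\<close>

lemma flex_neg:
  assumes "flex E x y l"
  shows "flex E x (neg_y E x y) (- l - wa1 E)"
proof -
  have "weq E x (neg_y E x y) = weq E x y"
    "weq_dy E x (neg_y E x y) = - weq_dy E x y"
    "weq_dx E x (neg_y E x y) + (- l - wa1 E) * - weq_dy E x y = weq_dx E x y + l * weq_dy E x y"
    "(- l - wa1 E)\<^sup>2 + wa1 E * (- l - wa1 E) = l\<^sup>2 + wa1 E * l"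
    by (simp_all add: neg_y_def weq_def weq_dx_def weq_dy_def algebra_simps power2_eq_square)
  then show ?thesis using assms by (simp add: flex_def)
qed

text \<open>For fixed \<open>x\<close> the equation is a monic quadratic in the ordinate.\<close>

lemma same_x_cases:
  assumes "weq E x y = 0" "weq E x y' = 0"
  shows "y' = y \<or> y' = neg_y E x y"
proof -
  have "(y' - y) * (y' - neg_y E x y) = weq E x y' - weq E x y"
    by (simp add: weq_def neg_y_def algebra_simps power2_eq_square)
  then show ?thesis using assms by auto
qed

section \<open>Coordinates centred at a flex\<close>

text \<open>Translation and shear give y^2 + A x y + B y = x^3 with A = \<open>wa1 E + 2 * l\<close>
  and B = \<open>weq_dy E x0 y0\<close>; scaling by \<open>u\<close> turns B into 1 and A into
  \<open>a\<close>. With \<open>u\<close> as a parameter the locale also serves over the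
  closure.\<close>

locale flex_coordinates =
  fixes E :: "'a::field weierstrass" and x0 y0 l u a :: 'a
  assumes flex: "flex E x0 y0 l"
    and u_cube: "u ^ 3 = weq_dy E x0 y0"
    and u_a: "u * a = wa1 E + 2 * l"
begin

lemma u_nonzero: "u \<noteq> 0"
  using flex u_cube by (auto simp: flex_def)

text \<open>Triangular form: each right-hand side contains only coefficients eliminated further
  down, so unfolding leaves polynomial identities.\<close>

lemma coefficients:
  "wa6 E = y0\<^sup>2 + wa1 E * x0 * y0 + wa3 E * y0 - x0 ^ 3 - wa2 E * x0\<^sup>2 - wa4 E * x0"
  "wa4 E = wa1 E * y0 - 3 * x0\<^sup>2 - 2 * wa2 E * x0 + l * u ^ 3"
  "wa3 E = u ^ 3 - 2 * y0 - wa1 E * x0"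
  "wa2 E = l\<^sup>2 + wa1 E * l - 3 * x0"
  "wa1 E = u * a - 2 * l"
  using flex u_a unfolding flex_def u_cube[symmetric]
  by (simp_all add: u_cube) (simp_all add: weq_def weq_dx_def weq_dy_def algebra_simps)

lemma weq_transform:
  "weq E (u\<^sup>2 * x + x0) (u ^ 3 * y + l * u\<^sup>2 * x + y0) = u ^ 6 * weq (normal_form a) x y"
  unfolding weq_def weierstrass.sel coefficients by Groebner_Basis.algebra

lemma weq_dy_transform:
  "weq_dy E (u\<^sup>2 * x + x0) (u ^ 3 * y + l * u\<^sup>2 * x + y0) = u ^ 3 * weq_dy (normal_form a) x y"
  unfolding weq_dy_def weierstrass.sel coefficients by Groebner_Basis.algebra

text \<open>Chain rule: \<open>weq_transform\<close> differentiated in \<open>x\<close>, with a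
  factor u^2 cancelled.\<close>

lemma weq_dx_transform:
  "weq_dx E (u\<^sup>2 * x + x0) (u ^ 3 * y + l * u\<^sup>2 * x + y0)
     + l * weq_dy E (u\<^sup>2 * x + x0) (u ^ 3 * y + l * u\<^sup>2 * x + y0) = u ^ 4 * weq_dx (normal_form a) x y"
  unfolding weq_dx_def weq_dy_def weierstrass.sel coefficients by Groebner_Basis.algebra

definition to_normal :: "'a point \<Rightarrow> 'a point" where
  "to_normal P = (case P of Infinity \<Rightarrow> Infinity
     | Affine x y \<Rightarrow> Affine ((x - x0) / u\<^sup>2) ((y - y0 - l * (x - x0)) / u ^ 3))"

definition from_normal :: "'a point \<Rightarrow> 'a point" where
  "from_normal P = (case P of Infinity \<Rightarrow> Infinity
     | Affine x y \<Rightarrow> Affine (u\<^sup>2 * x + x0) (u ^ 3 * y + l * u\<^sup>2 * x + y0))"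

lemma from_to_normal: "from_normal (to_normal P) = P"
  using u_nonzero by (cases P) (auto simp: to_normal_def from_normal_def)

lemma to_from_normal: "to_normal (from_normal P) = P"
  using u_nonzero by (cases P) (auto simp: to_normal_def from_normal_def algebra_simps)

lemma from_normal_points_iff: "from_normal P \<in> points E \<longleftrightarrow> P \<in> points (normal_form a)"
  using u_nonzero by (cases P) (auto simp: from_normal_def points_def weq_transform)

lemma to_normal_points: "P \<in> points E \<Longrightarrow> to_normal P \<in> points (normal_form a)"
  by (metis from_normal_points_iff from_to_normal)

text \<open>The coordinate change carries lines of slope \<open>m\<close> to lines of slope
  \<open>u * m + l\<close>.\<close>

lemma flex_transform:
  assumes "flex E (u\<^sup>2 * x + x0) (u ^ 3 * y + l * u\<^sup>2 * x + y0) (u * m + l)"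
  shows "flex (normal_form a) x y m"
proof -
  let ?x = "u\<^sup>2 * x + x0" and ?y = "u ^ 3 * y + l * u\<^sup>2 * x + y0"
  have "u ^ 4 * (weq_dx (normal_form a) x y + m * weq_dy (normal_form a) x y)
      = u ^ 4 * weq_dx (normal_form a) x y + u * m * (u ^ 3 * weq_dy (normal_form a) x y)"
    by Groebner_Basis.algebra
  also have "\<dots> = weq_dx E ?x ?y + (u * m + l) * weq_dy E ?x ?y"
    unfolding weq_dx_transform[symmetric] weq_dy_transform[symmetric] by Groebner_Basis.algebra
  finally have "u ^ 4 * (weq_dx (normal_form a) x y + m * weq_dy (normal_form a) x y) = 0"
    using assms by (simp add: flex_def)
  moreover have "u\<^sup>2 * (m\<^sup>2 + a * m - 3 * x)
      = (u * m + l)\<^sup>2 + wa1 E * (u * m + l) - wa2 E - 3 * (u\<^sup>2 * x + x0)"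
    unfolding coefficients by Groebner_Basis.algebra
  then have "u\<^sup>2 * (m\<^sup>2 + a * m - 3 * x) = 0"
    using assms by (simp add: flex_def)
  ultimately show ?thesis
    using assms u_nonzero
    by (auto simp: flex_def weq_transform weq_dy_transform)
qed

end

section \<open>Rational 3-torsion\<close>

lemma normal_form_flex:
  assumes "flex (normal_form a) x y m" and "x \<noteq> 0"
  defines "w \<equiv> (1 - y) / (2 * y + a * x + 1)"
  shows "w\<^sup>2 + w + 1 = 0"
proof -
  define d where "d = 2 * y + a * x + 1"
  have c: "y\<^sup>2 + a * x * y + y = x ^ 3" and d: "d \<noteq> 0"
    and t: "m * d = 3 * x\<^sup>2 - a * y" and m: "m\<^sup>2 + a * m = 3 * x"
    using assms(1) by (auto simp: d_def flex_def weq_def weq_dx_def weq_dy_def algebra_simps)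
  \<comment> \<open>The left side is the third division polynomial; the last bracket is the slope
    condition multiplied by \<open>d\<^sup>2\<close>.\<close>
  have "x * (3 * x ^ 3 + a\<^sup>2 * x\<^sup>2 + 3 * a * x + 3) 
      = (a\<^sup>2 + 12 * x) * (x ^ 3 - (y\<^sup>2 + a * x * y + y))
        - ((3 * x\<^sup>2 - a * y)\<^sup>2 + a * (3 * x\<^sup>2 - a * y) * d - 3 * x * d\<^sup>2)"
    unfolding d_def by Groebner_Basis.algebra
  also have "\<dots> = - ((m * d)\<^sup>2 + a * (m * d) * d - (m\<^sup>2 + a * m) * d\<^sup>2)"
    by (simp only: c t m diff_self mult_zero_right diff_0)
  also have "\<dots> = 0" by Groebner_Basis.algebra
  finally have "3 * x ^ 3 + a\<^sup>2 * x\<^sup>2 + 3 * a * x + 3 = 0" using \<open>x \<noteq> 0\<close> by simp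
  \<comment> \<open>Modulo the curve equation this expression equals the cubic just shown to
    vanish.\<close>
  then have "(1 - y)\<^sup>2 + (1 - y) * d + d\<^sup>2 = 0" using c d_def by Groebner_Basis.algebra
  moreover have "w * d = 1 - y" using d by (simp add: w_def d_def)
  ultimately have "(w\<^sup>2 + w + 1) * d\<^sup>2 = 0" by Groebner_Basis.algebra
  then show ?thesis using d by simp
qed

text \<open>On a finite field injectivity of cubing gives surjectivity, which supplies
  \<open>u\<close>.\<close>

lemma flex_coordinates_exist:
  assumes "[int CARD('a::{field,finite}) = - 1] (mod 3)" and "flex E x0 y0 (l :: 'a)"
  obtains u a where "flex_coordinates E x0 y0 l u a"
proof -
  have "surj (\<lambda>x :: 'a. x ^ 3)"
    using inj_cube[OF assms(1)] by (simp add: finite_UNIV_inj_surj)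
  then obtain u where u: "u ^ 3 = weq_dy E x0 y0" by (metis surjD)
  then have "u \<noteq> 0" using assms(2) by (auto simp: flex_def)
  then have "flex_coordinates E x0 y0 l u ((wa1 E + 2 * l) / u)"
    using assms(2) u by unfold_locales auto
  then show thesis by (rule that)
qed

text \<open>With the first flex moved to the origin, the second must have abscissa 0, or it would
  yield a primitive cube root of unity.\<close>

lemma flex_unique:
  assumes q: "[int CARD('a::{field,finite}) = - 1] (mod 3)"
    and f0: "flex E x0 y0 (l :: 'a)" and f1: "flex E x1 y1 m"
  shows "x1 = x0"
proof -
  obtain u a where "flex_coordinates E x0 y0 l u a"
    using flex_coordinates_exist[OF q f0] .
  then interpret flex_coordinates E x0 y0 l u a .
  let ?x = "(x1 - x0) / u\<^sup>2" and ?y = "(y1 - y0 - l * (x1 - x0)) / u ^ 3" and ?m = "(m - l) / u"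
  have "flex (normal_form a) ?x ?y ?m"
    by (rule flex_transform) (use f1 u_nonzero in simp)
  then have "?x = 0"
    using normal_form_flex no_primitive_cube_root[OF q] by blast
  then show ?thesis using u_nonzero by simp
qed

lemma carrier_torsion_3:
  assumes q: "[int CARD('a::{field,finite}) = - 1] (mod 3)" and f: "flex E x y (l :: 'a)"
  shows "carrier (torsion 3 (point_group E)) =
           {Infinity, Affine x y, Affine x (neg_y E x y)}" (is "?T = ?S")
proof -
  have "Affine x' y' \<in> ?T \<longleftrightarrow> weq E x' y' = 0 \<and> (\<exists>m. flex E x' y' m)" for x' y'
    using triple_eq_Infinity_iff_flex[of E x' y']
    by (auto simp: torsion_def pt_pow_3) (auto simp: point_group_def points_def)
  then have mem: "Affine x' y' \<in> ?T \<longleftrightarrow> (\<exists>m. flex E x' y' m)" for x' y'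
    by (auto simp: flex_def)
  have inf: "Infinity \<in> ?T"
    by (simp add: torsion_def pt_pow_3) (simp add: point_group_def points_def)
  have "P \<in> ?T \<longleftrightarrow> P \<in> ?S" for P
  proof (cases P)
    case Infinity
    then show ?thesis using inf by simp
  next
    case P: (Affine x' y')
    have "x' = x \<and> (y' = y \<or> y' = neg_y E x y)" if "flex E x' y' m" for m
      using flex_unique[OF q f that] f that same_x_cases[of E x y y'] by (simp add: flex_def)
    then show ?thesis
      unfolding P mem using f flex_neg[OF f] by auto
  qed
  then show ?thesis by blast
qed

text \<open>The full multiplication table replaces any appeal to associativity of the
  chord-and-tangent law.\<close>

lemma group_cyclic_three_elements:
  fixes G (structure)
  assumes carrier: "carrier G = {\<one>, p, n}"
    and one: "\<one> \<otimes> \<one> = \<one>" "\<one> \<otimes> p = p" "\<one> \<otimes> n = n" "p \<otimes> \<one> = p" "n \<otimes> \<one> = n"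
    and pn: "p \<otimes> p = n" "p \<otimes> n = \<one>" "n \<otimes> p = \<one>" "n \<otimes> n = p"
  shows "group G" and "cyclic_group G"
proof -
  show "group G"
    by (rule groupI) (use one pn in \<open>auto simp: carrier\<close>)
  then interpret group G .
  have "carrier G = range (\<lambda>i :: int. p [^] i)"
  proof
    have "\<one> = p [^] (0 :: int)" "p = p [^] (1 :: int)" "n = p [^] (2 :: int)"
      using pn(1) by (simp_all add: carrier int_pow_def2 numeral_2_eq_2 one)
    then show "carrier G \<subseteq> range (\<lambda>i :: int. p [^] i)" unfolding carrier by blast
    show "range (\<lambda>i :: int. p [^] i) \<subseteq> carrier G" using int_pow_closed[of p] by (auto simp: carrier)
  qed
  then show "cyclic_group G" unfolding cyclic_group using carrier by blast
qed

lemma torsion_3_cyclic: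
  assumes q: "[int CARD('a::{field,finite}) = - 1] (mod 3)" and f: "flex E x y (l :: 'a)"
  shows "group (torsion 3 (point_group E))" and "cyclic_group (torsion 3 (point_group E))"
proof -
  let ?G = "torsion 3 (point_group E)" and ?P = "Affine x y" and ?N = "Affine x (neg_y E x y)"
  have ops: "\<one>\<^bsub>?G\<^esub> = Infinity" "(\<otimes>\<^bsub>?G\<^esub>) = pt_add E"
    by (simp_all add: torsion_def point_group_def)
  have table: "pt_add E ?P ?P = ?N" "pt_add E ?P ?N = Infinity" "pt_add E ?N ?P = Infinity"
    "pt_add E ?N ?N = ?P"
    using pt_add_flex_double[OF f] pt_add_flex_double[OF flex_neg[OF f]]
      pt_add_neg[of E x y] pt_add_neg[of E x "neg_y E x y"] by auto
  note rules = group_cyclic_three_elements[of ?G ?P ?N, unfolded ops, OF carrier_torsion_3[OF q f]]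
  show "group ?G" "cyclic_group ?G" by (rule rules; simp add: table del: pt_add.simps(3))+
qed

lemma has_order_3_imp_flex:
  assumes "has_order (point_group E) P 3"
  obtains x y l where "flex E x y l"
proof (cases P)
  case Infinity
  \<comment> \<open>The exponent 1 < 3 in \<open>has_order\<close> excludes the identity.\<close>
  have "P [^]\<^bsub>point_group E\<^esub> (1 :: nat) \<noteq> \<one>\<^bsub>point_group E\<^esub>"
    using assms unfolding has_order_def by (metis less_one one_less_numeral_iff semiring_norm(77))
  then show thesis by (simp add: Infinity point_group_def)
next
  case (Affine x y)
  have "pt_add E (pt_add E P P) P = Infinity" "P \<in> points E"
    using assms unfolding has_order_def pt_pow_3 by (simp_all add: point_group_def)
  then show thesis
    using that triple_eq_Infinity_iff_flex[of E x y] by (auto simp: Affine points_def)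
qed

section \<open>Base change to the closure: isomorphism and smoothness\<close>

lemma to_ac_weq:
  "weq (closure_curve E) (to_ac x) (to_ac y) = to_ac (weq E x y)"
  "weq_dx (closure_curve E) (to_ac x) (to_ac y) = to_ac (weq_dx E x y)"
  "weq_dy (closure_curve E) (to_ac x) (to_ac y) = to_ac (weq_dy E x y)"
  by (simp_all add: weq_def weq_dx_def weq_dy_def weierstrass.map_sel)

lemma closure_normal_form: "closure_curve (normal_form a) = normal_form (to_ac a)"
  by simp

lemma flex_coordinates_to_ac:
  assumes "flex_coordinates E x0 y0 l u a"
  shows "flex_coordinates (closure_curve E) (to_ac x0) (to_ac y0) (to_ac l) (to_ac u) (to_ac a)"
proof -
  interpret flex_coordinates E x0 y0 l u a by fact
  have "to_ac (u ^ 3) = to_ac (weq_dy E x0 y0)" "to_ac (u * a) = to_ac (wa1 E + 2 * l)"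
    "to_ac (l\<^sup>2 + wa1 E * l - wa2 E) = to_ac (3 * x0)"
    "to_ac (weq_dx E x0 y0 + l * weq_dy E x0 y0) = to_ac 0"
    using flex u_cube u_a unfolding flex_def by simp_all
  then show ?thesis
    using flex by unfold_locales (simp_all add: flex_def to_ac_weq weierstrass.map_sel)
qed

text \<open>One triple of linear forms represents the map at every point; its value at
  \<open>Infinity\<close> is (0, s, 0), which is why \<open>s\<close> must be nonzero.\<close>

lemma curve_morphism_affine:
  fixes E E' :: "'a::field weierstrass" and p q r s t :: 'a
  defines "\<phi> \<equiv> \<lambda>P. case P of Infinity \<Rightarrow> Infinity
     | Affine x y \<Rightarrow> Affine (to_ac p * x + to_ac q) (to_ac r * x + to_ac s * y + to_ac t)"
  assumes s: "s \<noteq> 0"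
    and points: "\<And>P. P \<in> points (closure_curve E) \<Longrightarrow> \<phi> P \<in> points (closure_curve E')"
  shows "curve_morphism E E' \<phi>"
proof -
  \<comment> \<open>Coefficients of the form a x + b y + c z; only the indices with i + j at most 1
    are evaluated.\<close>
  define lin :: "'a \<Rightarrow> 'a \<Rightarrow> 'a \<Rightarrow> nat \<Rightarrow> nat \<Rightarrow> 'a" where
    "lin = (\<lambda>a b c i j. if i = 1 then a else if j = 1 then b else c)"
  have lin: "form_val 1 (lin a b c) (x, y, z) = to_ac a * x + to_ac b * y + to_ac c * z"
    for a b c and x y z :: "'a alg_closure"
    by (simp add: form_val_def lin_def)
  let ?f = "forms_at 1 (lin p 0 q) (lin r s t) (lin 0 0 1)"
  have f: "?f Infinity = (0, to_ac s, 0)"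
    "?f (Affine x y) = (to_ac p * x + to_ac q, to_ac r * x + to_ac s * y + to_ac t, 1)" for x y
    by (simp_all add: forms_at_def lin del: One_nat_def)
  have nz: "?f P \<noteq> (0, 0, 0)" for P
    by (cases P) (simp_all add: f s del: One_nat_def)
  have k: "\<exists>k. k \<noteq> 0 \<and> ?f Q = (case hom_coords (\<phi> Q) of (x, y, z) \<Rightarrow> (k * x, k * y, k * z))" for Q
  proof (cases Q)
    case Infinity
    then show ?thesis using s by (intro exI[of _ "to_ac s"]) (simp add: f \<phi>_def del: One_nat_def)
  next
    case (Affine x y)
    then show ?thesis by (intro exI[of _ 1]) (simp add: f \<phi>_def del: One_nat_def)
  qed
  show ?thesis
    unfolding curve_morphism_def using points nz k by blast
qed

lemma (in flex_coordinates) isomorphic_normal_form: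
  "isomorphic_over_base E (normal_form a)"
proof -
  interpret ac: flex_coordinates "closure_curve E" "to_ac x0" "to_ac y0" "to_ac l" "to_ac u" "to_ac a"
    by (rule flex_coordinates_to_ac) unfold_locales
  \<comment> \<open>Writing every coefficient as a \<open>to_ac\<close> image shows that the map is
    defined over the base field.\<close>
  have to: "ac.to_normal = (\<lambda>P. case P of Infinity \<Rightarrow> Infinity
     | Affine x y \<Rightarrow> Affine (to_ac (1 / u\<^sup>2) * x + to_ac (- x0 / u\<^sup>2))
         (to_ac (- l / u ^ 3) * x + to_ac (1 / u ^ 3) * y + to_ac ((l * x0 - y0) / u ^ 3)))"
    using u_nonzero
    by (auto simp: fun_eq_iff ac.to_normal_def field_simps split: point.split)
  have "from": "ac.from_normal = (\<lambda>P. case P of Infinity \<Rightarrow> Infinity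
     | Affine x y \<Rightarrow> Affine (to_ac (u\<^sup>2) * x + to_ac x0)
         (to_ac (l * u\<^sup>2) * x + to_ac (u ^ 3) * y + to_ac y0))"
    by (auto simp: fun_eq_iff ac.from_normal_def algebra_simps split: point.split)
  have "curve_morphism E (normal_form a) ac.to_normal"
    unfolding to
    by (rule curve_morphism_affine)
      (use u_nonzero ac.to_normal_points in \<open>simp_all add: to[symmetric]
        del: to_ac_divide to_ac_minus to_ac_mult to_ac_power to_ac_diff\<close>)
  moreover have "curve_morphism (normal_form a) E ac.from_normal"
    unfolding "from"
    by (rule curve_morphism_affine)
      (use u_nonzero ac.from_normal_points_iff in \<open>simp_all add: from[symmetric]
        del: to_ac_mult to_ac_power\<close>)
  moreover have "ac.to_normal Infinity = Infinity" by (simp add: ac.to_normal_def)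
  ultimately show ?thesis
    unfolding isomorphic_over_base_def
    using ac.from_to_normal ac.to_from_normal by blast
qed

text \<open>For \<open>a = 3\<close> the normal form has the node \<open>(-1, 1)\<close>.\<close>

lemma (in flex_coordinates) elliptic_imp_neq_3:
  assumes "elliptic_curve E"
  shows "a \<noteq> 3"
proof
  assume a: "a = 3"
  define x where "x = u\<^sup>2 * (- 1) + x0"
  define y where "y = u ^ 3 * 1 + l * u\<^sup>2 * (- 1) + y0"
  have "weq E x y = 0" "weq_dy E x y = 0"
    unfolding x_def y_def weq_transform weq_dy_transform by (simp_all add: a weq_def weq_dy_def)
  moreover have "weq_dx E x y + l * weq_dy E x y = 0"
    unfolding x_def y_def weq_dx_transform by (simp add: a weq_dx_def)
  ultimately show False
    using assms to_ac_weq[of E x y] unfolding elliptic_curve_def by auto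
qed

text \<open>A singular point would have y = 1, a x = -3 and x^3 = -1, forcing a^3 = 27.\<close>

lemma elliptic_normal_form:
  assumes "a ^ 3 \<noteq> (27 :: 'a::field)"
  shows "elliptic_curve (normal_form a)"
  unfolding elliptic_curve_def closure_normal_form
proof (intro notI, elim exE conjE)
  fix x y :: "'a alg_closure"
  let ?a = "to_ac a"
  assume "weq (normal_form ?a) x y = 0" "weq_dx (normal_form ?a) x y = 0"
    "weq_dy (normal_form ?a) x y = 0"
  then have c: "y\<^sup>2 + ?a * x * y + y = x ^ 3" and dx: "?a * y = 3 * x\<^sup>2"
    and dy: "2 * y + ?a * x + 1 = 0"
    by (simp_all add: weq_def weq_dx_def weq_dy_def)
  \<comment> \<open>A combination of the curve equation and both partials in which \<open>x\<close>
    cancels, valid in every characteristic.\<close>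
  have "y * (1 - y) = 3 * (y\<^sup>2 + ?a * x * y + y - x ^ 3) + x * (3 * x\<^sup>2 - ?a * y)
      - 2 * y * (2 * y + ?a * x + 1)"
    by Groebner_Basis.algebra
  then have "y * (1 - y) = 0" by (simp add: c dx dy)
  moreover have "y \<noteq> 0"
  proof
    assume "y = 0"
    moreover from this c have "x = 0" by simp
    ultimately show False using dy by simp
  qed
  ultimately have y: "y = 1" by simp
  have ax: "?a * x = - 3" using dy y by (simp add: add_eq_0_iff)
  then have "x ^ 3 = - 1" using c y by simp
  moreover have "(?a * x) ^ 3 = - 27" by (simp add: ax)
  ultimately have "?a ^ 3 = 27" by (simp add: power_mult_distrib)
  then have "to_ac (a ^ 3) = to_ac 27" by simp
  then show False using assms by (simp only: to_ac_eq_iff)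
qed

theorem theorem2:
  assumes "[int CARD('a::{field,finite}) = - 1] (mod 3)"
  shows "(\<forall>E :: 'a weierstrass.
            elliptic_curve E \<and> (\<exists>P. has_order (point_group E) P 3) \<longrightarrow>
              (\<exists>a :: 'a. a \<noteq> 3 \<and> isomorphic_over_base E (Weierstrass a 0 1 0 0)) \<and>
              group (torsion 3 (point_group E)) \<and>
              cyclic_group (torsion 3 (point_group E))) \<and>
         (\<forall>a :: 'a. a \<noteq> 3 \<longrightarrow>
            elliptic_curve (Weierstrass a 0 1 0 0) \<and>
            group (torsion 3 (point_group (Weierstrass a 0 1 0 0))) \<and>
            cyclic_group (torsion 3 (point_group (Weierstrass a 0 1 0 0))))"
proof (intro conjI allI impI; (elim conjE exE)?)
  fix E :: "'a weierstrass" and P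
  assume E: "elliptic_curve E" and "has_order (point_group E) P 3"
  then obtain x y l where f: "flex E x y l" using has_order_3_imp_flex by blast
  then show "group (torsion 3 (point_group E))" "cyclic_group (torsion 3 (point_group E))"
    using torsion_3_cyclic[OF assms] by blast+
  obtain u a where "flex_coordinates E x y l u a"
    using flex_coordinates_exist[OF assms f] .
  then show "\<exists>a :: 'a. a \<noteq> 3 \<and> isomorphic_over_base E (Weierstrass a 0 1 0 0)"
    using E flex_coordinates.isomorphic_normal_form flex_coordinates.elliptic_imp_neq_3 by blast
next
  fix a :: 'a
  \<comment> \<open>The origin is a flex with tangent y = 0.\<close>
  have f: "flex (normal_form a) 0 0 0"
    by (simp add: flex_def weq_def weq_dx_def weq_dy_def)
  show "group (torsion 3 (point_group (Weierstrass a 0 1 0 0)))"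
    "cyclic_group (torsion 3 (point_group (Weierstrass a 0 1 0 0)))"
    using torsion_3_cyclic[OF assms f] by blast+
  assume "a \<noteq> 3"
  \<comment> \<open>27 is the cube of 3, and cubing is injective.\<close>
  then have "a ^ 3 \<noteq> 27" using injD[OF inj_cube[OF assms], of a 3] by auto
  then show "elliptic_curve (Weierstrass a 0 1 0 0)" by (rule elliptic_normal_form)
qed

end
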